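(* For every integer $k\ge 2$ there is a constant $c_k>0$ (depending only on $k$) such that for all integers $n\ge k$, \[ D(n,k)\ \ge\ c_k\,\frac{2^n\log n}{n^{2k}}. \] That is, $D(n,k)\ge \Omega_k(2^n\log n/n^{2k})$.
   Context: Words are finite binary strings. A word $w$ is a subsequence of $u$ if $w$ is obtained from $u$ by deleting some letters. For $u,v\in\{0,1\}^n$, $\mathrm{LCS}(u,v)$ is the maximum length of a common subsequence of $u$ and $v$, and the deletion distance is $\mathrm{d}(u,v)=n-\mathrm{LCS}(u,v)$. A set $C\subseteq\{0,1\}^n$ is a $k$-deletion code if every pair of distinct words in $C$ has deletion distance greater than $k$ (equivalently, no word of length $n-k$ is a subsequence of two distinct words of $C$). $D(n,k)$ denotes the maximum size of a $k$-deletion code $C\subseteq\{0,1\}^n$. Logarithms are base $2$. *)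

theory Defs
  imports Complex_Main "HOL-Library.Sublist"
begin

type_synonym word = "bool list"

definition words :: "nat \<Rightarrow> word set" where
  "words n = {w. length w = n}"

definition LCS :: "word \<Rightarrow> word \<Rightarrow> nat" where
  "LCS u v = Max {length w | w. subseq w u \<and> subseq w v}"

text \<open>The deletion distance is meant for words of equal length \<open>n = length u = length v\<close>;
  the subtraction never truncates, since a common subsequence is no longer than \<open>u\<close>.\<close>

definition deletion_distance :: "word \<Rightarrow> word \<Rightarrow> nat" where
  "deletion_distance u v = length u - LCS u v"

definition deletion_code :: "nat \<Rightarrow> nat \<Rightarrow> word set \<Rightarrow> bool" where
  "deletion_code n k C \<longleftrightarrow>
     C \<subseteq> words n \<and> (\<forall>u\<in>C. \<forall>v\<in>C. u \<noteq> v \<longrightarrow> deletion_distance u v > k)"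

definition max_code_size :: "nat \<Rightarrow> nat \<Rightarrow> nat" where
  "max_code_size n k = Max {card C | C. deletion_code n k C}"

text \<open>Each \<open>Max\<close> above is taken over a finite nonempty set, so it is a genuine maximum.\<close>

lemma common_subseq_lengths:
  "finite {length w | w. subseq w u \<and> subseq w v}"
  "{length w | w. subseq w u \<and> subseq w v} \<noteq> {}"
proof -
  have "{length w | w. subseq w u \<and> subseq w v} \<subseteq> {..length u}"
    by (auto dest: list_emb_length)
  then show "finite {length w | w. subseq w u \<and> subseq w v}"
    by (rule finite_subset) simp
  show "{length w | w. subseq w u \<and> subseq w v} \<noteq> {}"
    using list_emb_Nil by blast
qed

lemma finite_words: "finite (words n)"
  using finite_lists_length_eq[of "UNIV :: bool set" n] by (simp add: words_def)

lemma code_sizes: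
  "finite {card C | C. deletion_code n k C}"
  "{card C | C. deletion_code n k C} \<noteq> {}"
proof -
  have "{card C | C. deletion_code n k C} \<subseteq> card ` Pow (words n)"
    by (auto simp: deletion_code_def)
  then show "finite {card C | C. deletion_code n k C}"
    by (rule finite_subset) (simp add: finite_words)
  have "deletion_code n k {}" by (simp add: deletion_code_def)
  then show "{card C | C. deletion_code n k C} \<noteq> {}" by blast
qed

end

theory Submission
  imports Defs "HOL-Real_Asymp.Real_Asymp"
begin

text \<open>Join two words when their deletion distance is at most \<open>k\<close>; a code is an independent set.
  Discard the words, at most half of all, that have a window of logarithmic length with a period
  of at most \<open>3 k\<close>. Degrees are at most \<open>2^k n^(2k)\<close>. If \<open>u\<close>, \<open>v\<close>, \<open>w\<close> form a triangle, the
  \<open>4 k\<close> positions deleted to align \<open>u\<close> with \<open>v\<close> and \<open>u\<close> with \<open>w\<close> cannot be pairwise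
  far apart: the alignment of \<open>v\<close> with \<open>w\<close> deletes only \<open>2 k\<close> positions, so some position \<open>p\<close> among
  the \<open>4 k\<close> would be the only deletion in a large neighbourhood, and then the two routes
  from \<open>u\<close> to \<open>w\<close> differ by a nonzero shift on one side of \<open>p\<close>, which makes \<open>w\<close> periodic there.
  Hence every neighbourhood spans only \<open>O(n^(4k-1) log n)\<close> edges. For such locally sparse
  graphs the expected size of an independent set drawn from the hard-core model at a suitable
  fugacity beats the greedy bound by a logarithmic factor.\<close>

section \<open>Independent sets in locally sparse graphs\<close>

definition indep_sets :: "('a \<Rightarrow> 'a \<Rightarrow> bool) \<Rightarrow> 'a set \<Rightarrow> 'a set set" where
  "indep_sets E J = {R. R \<subseteq> J \<and> (\<forall>x\<in>R. \<forall>y\<in>R. \<not> E x y)}"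

lemma finite_indep_sets: "finite J \<Longrightarrow> finite (indep_sets E J)"
  by (rule finite_subset[of _ "Pow J"]) (auto simp: indep_sets_def)

lemma empty_in_indep_sets: "{} \<in> indep_sets E J"
  by (simp add: indep_sets_def)

lemma finite_mem_indep_sets: "finite J \<Longrightarrow> R \<in> indep_sets E J \<Longrightarrow> finite R"
  by (auto simp: indep_sets_def intro: finite_subset)

lemma sum_power_card_Pow:
  fixes l :: real
  assumes "finite A"
  shows "(\<Sum>R\<in>Pow A. l ^ card R) = (1 + l) ^ card A"
proof -
  have "(\<Prod>x\<in>A. l + 1) = (\<Sum>R\<in>Pow A. (\<Prod>x\<in>R. l) * (\<Prod>x\<in>A-R. 1))"
    using assms by (rule prod_add)
  then show ?thesis by (simp add: add.commute)
qed

lemma hard_core_partition_le: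
  fixes l :: real
  assumes "finite J" "l \<ge> 0"
  shows "(\<Sum>R\<in>indep_sets E J. l ^ card R) \<le> (1 + l) ^ card J"
proof -
  have "(\<Sum>R\<in>indep_sets E J. l ^ card R) \<le> (\<Sum>R\<in>Pow J. l ^ card R)"
    using assms by (intro sum_mono2) (auto simp: indep_sets_def)
  then show ?thesis using sum_power_card_Pow[OF assms(1)] by simp
qed

lemma hard_core_partition_ge_1:
  fixes l :: real and J :: "'a set"
  assumes "finite J" "l \<ge> 0"
  shows "(\<Sum>R\<in>indep_sets E J. l ^ card R) \<ge> 1"
proof -
  have "(\<Sum>R\<in>{{}::'a set}. l ^ card R) \<le> (\<Sum>R\<in>indep_sets E J. l ^ card R)"
    using assms by (intro sum_mono2) (auto simp: finite_indep_sets empty_in_indep_sets)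
  then show ?thesis by simp
qed

text \<open>Removing \<open>x\<close> matches the independent sets containing \<open>x\<close> with
  those to which \<open>x\<close> can be added, so \<open>P x = l * Q x\<close>. Every independent
  set contains \<open>x\<close>, contains a neighbour of \<open>x\<close>, or can be extended by
  \<open>x\<close>. With \<open>P y\<close> at most \<open>l * Z\<close>, this bounds
  \<open>P x\<close> from below, and summing over \<open>x\<close> gives the mean size.
  \<open>M\<close> bounds the number of ordered adjacent pairs.\<close>

lemma hard_core_mean_size:
  fixes l :: real and E :: "'a \<Rightarrow> 'a \<Rightarrow> bool"
  assumes J: "finite J" and l: "l > 0"
    and sym: "\<And>x y. E x y \<Longrightarrow> E y x" and irr: "\<And>x. \<not> E x x"
    and M: "real (card {(x, y). x \<in> J \<and> y \<in> J \<and> E x y}) \<le> M"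
  shows "l * (\<Sum>R\<in>indep_sets E J. l ^ card R) * (real (card J) * (1 - l) - l * M)
     \<le> (\<Sum>R\<in>indep_sets E J. real (card R) * l ^ card R)"
proof -
  let ?I = "indep_sets E J"
  let ?w = "\<lambda>R::'a set. l ^ card R"
  define Z where "Z = (\<Sum>R\<in>?I. ?w R)"
  define P where "P x = (\<Sum>R\<in>?I. ?w R * of_bool (x \<in> R))" for x
  define Q where "Q x = (\<Sum>R\<in>?I. ?w R * of_bool (x \<notin> R \<and> (\<forall>y\<in>R. \<not> E x y)))" for x
  have finI: "finite ?I" using J by (rule finite_indep_sets)
  have PQ: "P x = l * Q x" if "x \<in> J" for x
  proof -
    have "P x = (\<Sum>R\<in>{R\<in>?I. x \<in> R}. ?w R)"
      unfolding P_def by (rule sum.mono_neutral_cong_right) (use finI in auto)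
    also have "\<dots> = (\<Sum>R\<in>{R\<in>?I. x \<notin> R \<and> (\<forall>y\<in>R. \<not> E x y)}. l * ?w R)"
    proof (rule sum.reindex_bij_witness[of _ "insert x" "\<lambda>R. R - {x}"])
      fix R assume R: "R \<in> {R \<in> ?I. x \<in> R}"
      then have "finite R" using finite_mem_indep_sets[OF J] by auto
      then have "card R = Suc (card (R - {x}))" using R by (metis (no_types, lifting) card.remove mem_Collect_eq)
      then show "l * l ^ card (R - {x}) = l ^ card R" by simp
    qed (use that sym irr in \<open>auto simp: indep_sets_def\<close>)
    also have "\<dots> = l * Q x"
      unfolding Q_def sum_distrib_left by (rule sum.mono_neutral_cong_left) (use finI in auto)
    finally show ?thesis .
  qed
  have Q_le: "Q x \<le> Z" for x unfolding Q_def Z_def using l by (intro sum_mono) auto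
  have P_le: "P x \<le> l * Z" if "x \<in> J" for x using PQ[OF that] Q_le[of x] l by simp
  have Z0: "Z \<ge> 0" unfolding Z_def using l by (intro sum_nonneg) auto
  have cover: "Z \<le> Q x + P x + (\<Sum>y\<in>{y\<in>J. E x y}. P y)" for x
  proof -
    have "Z \<le> (\<Sum>R\<in>?I. ?w R * of_bool (x \<notin> R \<and> (\<forall>y\<in>R. \<not> E x y)) + ?w R * of_bool (x \<in> R)
              + (\<Sum>y\<in>{y\<in>J. E x y}. ?w R * of_bool (y \<in> R)))"
      unfolding Z_def
    proof (rule sum_mono)
      fix R assume R: "R \<in> ?I"
      have w: "?w R \<ge> 0" using l by simp
      have nn: "(\<Sum>y\<in>{y\<in>J. E x y}. ?w R * of_bool (y \<in> R)) \<ge> 0"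
        using w by (intro sum_nonneg) auto
      show "?w R \<le> ?w R * of_bool (x \<notin> R \<and> (\<forall>y\<in>R. \<not> E x y)) + ?w R * of_bool (x \<in> R)
              + (\<Sum>y\<in>{y\<in>J. E x y}. ?w R * of_bool (y \<in> R))"
      proof (cases "\<exists>y\<in>R. E x y")
        case True
        then obtain y where y: "y \<in> R" "E x y" by blast
        then have "y \<in> J" using R by (auto simp: indep_sets_def)
        then have "?w R * of_bool (y \<in> R) \<le> (\<Sum>y\<in>{y\<in>J. E x y}. ?w R * of_bool (y \<in> R))"
          using y J w by (intro member_le_sum) auto
        then show ?thesis using y w by auto
      next
        case False
        then show ?thesis using nn by (cases "x \<in> R") auto
      qed
    qed
    also have "\<dots> = Q x + P x + (\<Sum>y\<in>{y\<in>J. E x y}. P y)"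
      unfolding Q_def P_def sum.distrib by (subst sum.swap) simp
    finally show ?thesis .
  qed
  have P_ge: "P x \<ge> l * Z * (1 - l - l * real (card {y\<in>J. E x y}))" if x: "x \<in> J" for x
  proof -
    have "(\<Sum>y\<in>{y\<in>J. E x y}. P y) \<le> (\<Sum>y\<in>{y\<in>J. E x y}. l * Z)"
      by (intro sum_mono) (use P_le in auto)
    then have "(\<Sum>y\<in>{y\<in>J. E x y}. P y) \<le> real (card {y\<in>J. E x y}) * (l * Z)" by simp
    then have "Q x \<ge> Z - l * Z - real (card {y\<in>J. E x y}) * (l * Z)"
      using cover[of x] P_le[OF x] by linarith
    then have "l * Q x \<ge> l * (Z - l * Z - real (card {y\<in>J. E x y}) * (l * Z))"
      using l by simp
    then show ?thesis using PQ[OF x] by (simp add: algebra_simps)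
  qed
  have "(\<Sum>R\<in>?I. real (card R) * ?w R) = (\<Sum>R\<in>?I. \<Sum>x\<in>J. ?w R * of_bool (x \<in> R))"
  proof (rule sum.cong[OF refl])
    fix R assume "R \<in> ?I"
    then have "R \<subseteq> J" by (simp add: indep_sets_def)
    then have "J \<inter> R = R" by auto
    then show "real (card R) * ?w R = (\<Sum>x\<in>J. ?w R * of_bool (x \<in> R))"
      using J by (simp flip: sum_distrib_left)
  qed
  also have "\<dots> = (\<Sum>x\<in>J. P x)" unfolding P_def by (rule sum.swap)
  also have "\<dots> \<ge> (\<Sum>x\<in>J. l * Z * (1 - l - l * real (card {y\<in>J. E x y})))"
    by (rule sum_mono) (rule P_ge)
  also have "(\<Sum>x\<in>J. l * Z * (1 - l - l * real (card {y\<in>J. E x y})))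
     = l * Z * (real (card J) * (1 - l) - l * (\<Sum>x\<in>J. real (card {y\<in>J. E x y})))"
    by (simp flip: sum_distrib_left add: sum_subtractf right_diff_distrib)
  also have "(\<Sum>x\<in>J. real (card {y\<in>J. E x y})) = real (card (SIGMA x:J. {y\<in>J. E x y}))"
    using J by simp
  also have "(SIGMA x:J. {y\<in>J. E x y}) = {(x, y). x \<in> J \<and> y \<in> J \<and> E x y}" by auto
  finally have "l * Z * (real (card J) * (1 - l) - l * real (card {(x, y). x \<in> J \<and> y \<in> J \<and> E x y}))
     \<le> (\<Sum>R\<in>?I. real (card R) * ?w R)" .
  moreover have "l * Z * (real (card J) * (1 - l) - l * M)
    \<le> l * Z * (real (card J) * (1 - l) - l * real (card {(x, y). x \<in> J \<and> y \<in> J \<and> E x y}))"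
    using M l Z0 by (intro mult_left_mono) auto
  ultimately show ?thesis unfolding Z_def by linarith
qed

text \<open>If the partition function is small, the term \<open>D * l\<close> wins; if it is large, \<open>J\<close> is large and the
  mean size of an independent subset of \<open>J\<close> wins.\<close>

lemma hard_core_occupancy:
  fixes l D K M :: real and E :: "'a \<Rightarrow> 'a \<Rightarrow> bool"
  assumes J: "finite J" and l: "l > 0" "l \<le> 1 / 4"
    and sym: "\<And>x y. E x y \<Longrightarrow> E y x" and irr: "\<And>x. \<not> E x x"
    and M: "real (card {(x, y). x \<in> J \<and> y \<in> J \<and> E x y}) \<le> M"
    and lM: "l^2 * M \<le> 1" and K: "K > 0" "2 * K \<le> D"
    and L: "4 * K \<le> ln (D * l / (2 * K))" "4 \<le> ln (D * l / (2 * K))"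
  shows "K * (l + (\<Sum>R\<in>indep_sets E J. l ^ card R))
    \<le> D * l + (\<Sum>R\<in>indep_sets E J. real (card R) * l ^ card R)"
proof -
  define Z where "Z = (\<Sum>R\<in>indep_sets E J. l ^ card R)"
  define Y where "Y = (\<Sum>R\<in>indep_sets E J. real (card R) * l ^ card R)"
  have Z1: "Z \<ge> 1" unfolding Z_def using hard_core_partition_ge_1[OF J] l by simp
  have Y0: "Y \<ge> 0" unfolding Y_def using l by (intro sum_nonneg) auto
  show ?thesis
  proof (cases "Z \<le> D * l / (2 * K)")
    case True
    then have "K * Z \<le> D * l / 2" using K by (simp add: field_simps)
    moreover have "K * l \<le> D / 2 * l" using K l by (intro mult_right_mono) auto
    ultimately have "K * (l + Z) \<le> D * l" by (simp add: algebra_simps)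
    then show ?thesis using Y0 unfolding Z_def Y_def by linarith
  next
    case False
    have D: "D * l / (2 * K) > 0" using K l by simp
    \<comment> \<open>The partition function is at most \<open>(1 + l) ^ card J\<close>, so a large
      \<open>Z\<close> forces \<open>card J * l\<close> to be at least the logarithm.\<close>
    have "ln (D * l / (2 * K)) \<le> ln Z" using False D by simp
    also have "\<dots> \<le> ln ((1 + l) ^ card J)"
      using hard_core_partition_le[OF J, of l E] Z1 l by (subst ln_le_cancel_iff) (auto simp: Z_def)
    also have "\<dots> = card J * ln (1 + l)" using l by (simp add: ln_realpow)
    also have "\<dots> \<le> card J * l" using l by (intro mult_left_mono ln_add_one_self_le_self) auto
    finally have lJ: "ln (D * l / (2 * K)) \<le> card J * l" .
    have "l * Z * (real (card J) * (1 - l) - l * M) \<le> Y"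
      unfolding Z_def Y_def by (rule hard_core_mean_size[OF J l(1) sym irr M])
    \<comment> \<open>Edges cost at most 1 because \<open>l^2 * M\<close> is at most 1. Since
      \<open>card J * l\<close> is at least 4, a quarter of it pays for that loss.\<close>
    moreover have "l * (real (card J) * (1 - l) - l * M) \<ge> card J * l / 2"
    proof -
      have "(card J * l) * (1 - l) \<ge> (card J * l) * (3 / 4)"
        using l by (intro mult_left_mono) auto
      moreover have "l * (l * M) \<le> 1" using lM by (simp add: power2_eq_square mult.assoc)
      ultimately show ?thesis using lJ L by (simp add: algebra_simps)
    qed
    then have "Z * (l * (real (card J) * (1 - l) - l * M)) \<ge> Z * (card J * l / 2)"
      using Z1 by (intro mult_left_mono) auto
    ultimately have "Z * (card J * l / 2) \<le> Y" by (simp add: algebra_simps)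
    moreover have "Z * (2 * K) \<le> Z * (card J * l / 2)"
      using Z1 lJ L by (intro mult_left_mono) auto
    moreover have "K * (l + Z) \<le> K * (2 * Z)" using K Z1 l by (intro mult_left_mono) auto
    moreover have "D * l \<ge> 0" using K l by simp
    ultimately show ?thesis unfolding Z_def Y_def by (simp add: algebra_simps)
  qed
qed

text \<open>A lower bound on a mean at a single vertex: \<open>v\<close> itself is worth
  \<open>D\<close>, each of its neighbours in \<open>I\<close> is worth 1, and the expected worth is
  at least \<open>K\<close>. The weight \<open>D\<close> balances the two kinds of contribution when
  they are summed over all vertices of a graph of maximum degree \<open>D\<close>.\<close>

lemma hard_core_local_bound:
  fixes l D K M :: real and E :: "'a \<Rightarrow> 'a \<Rightarrow> bool"
  assumes V: "finite V" and v: "v \<in> V" and l: "l > 0" "l \<le> 1 / 4"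
    and sym: "\<And>x y. E x y \<Longrightarrow> E y x" and irr: "\<And>x. \<not> E x x"
    and M: "real (card {(x, y). x \<in> V \<and> y \<in> V \<and> E v x \<and> E v y \<and> E x y}) \<le> M"
    and lM: "l^2 * M \<le> 1" and K: "K > 0" "2 * K \<le> D"
    and L: "4 * K \<le> ln (D * l / (2 * K))" "4 \<le> ln (D * l / (2 * K))"
  shows "K * (\<Sum>I\<in>indep_sets E V. l ^ card I)
    \<le> (\<Sum>I\<in>indep_sets E V. (D * of_bool (v \<in> I) + real (card {x\<in>I. E v x})) * l ^ card I)"
    (is "_ \<le> (\<Sum>I\<in>?I. ?f I)")
proof -
  \<comment> \<open>Condition on the part of \<open>I\<close> outside the closed neighbourhood of \<open>v\<close>.\<close>
  define g where "g I = {x\<in>I. x \<noteq> v \<and> \<not> E v x}" for I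
  have finI: "finite ?I" using V by (rule finite_indep_sets)
  have fib: "K * (\<Sum>I\<in>{I\<in>?I. g I = S}. l ^ card I) \<le> (\<Sum>I\<in>{I\<in>?I. g I = S}. ?f I)"
    if "S \<in> g ` ?I" for S
  proof -
    have SI: "S \<in> ?I" and Sv: "v \<notin> S" "\<And>x. x \<in> S \<Longrightarrow> \<not> E v x"
      using that by (auto simp: g_def indep_sets_def)
    have finS: "finite S" using finite_mem_indep_sets[OF V SI] .
    define J where "J = {x\<in>V. E v x \<and> (\<forall>y\<in>S. \<not> E x y)}"
    have J: "finite J" using V by (simp add: J_def)
    have sym': "\<not> E y x" if "\<not> E x y" for x y using that sym by blast
    \<comment> \<open>Once \<open>S\<close> is fixed, either \<open>v\<close> is added, which
      excludes all its neighbours, or an independent set of neighbours of \<open>v\<close> not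
      blocked by \<open>S\<close> is added.\<close>
    have fibre: "{I\<in>?I. g I = S} = insert (insert v S) ((\<union>) S ` indep_sets E J)" (is "?L = ?R")
    proof
      show "?R \<subseteq> ?L"
        using v SI Sv irr sym' unfolding indep_sets_def g_def J_def by auto
      show "?L \<subseteq> ?R"
      proof
        fix I assume I: "I \<in> ?L"
        show "I \<in> ?R"
        proof (cases "v \<in> I")
          case True
          then have "I = insert v S" using I by (auto simp: g_def indep_sets_def)
          then show ?thesis by simp
        next
          case False
          have "I = S \<union> {x\<in>I. E v x}" using I False by (auto simp: g_def)
          moreover have "{x\<in>I. E v x} \<in> indep_sets E J"
            using I by (auto simp: g_def indep_sets_def J_def)
          ultimately show ?thesis by blast
        qed
      qed
    qed
    have disj: "S \<inter> R = {}" "v \<notin> R" "finite R" "R \<subseteq> {x. E v x}" if "R \<in> indep_sets E J" for R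
      using that Sv irr finite_mem_indep_sets[OF J that] by (auto simp: indep_sets_def J_def)
    have inj: "inj_on ((\<union>) S) (indep_sets E J)"
      using disj by (intro inj_onI) blast
    have notin: "insert v S \<notin> (\<union>) S ` indep_sets E J"
      using Sv disj by blast
    have w: "l ^ card (S \<union> R) = l ^ card S * l ^ card R" if "R \<in> indep_sets E J" for R
      using disj[OF that] finS by (simp add: card_Un_disjoint power_add)
    have f: "?f (S \<union> R) = l ^ card S * (real (card R) * l ^ card R)" if "R \<in> indep_sets E J" for R
    proof -
      have "{x \<in> S \<union> R. E v x} = R" using disj[OF that] Sv by auto
      then show ?thesis using w[OF that] Sv disj[OF that] by simp
    qed
    have f0: "?f (insert v S) = l ^ card S * (D * l)"
    proof -
      have "{x \<in> insert v S. E v x} = {}" using Sv irr by auto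
      then have "card {x \<in> insert v S. E v x} = 0" by (metis card.empty)
      then show ?thesis using Sv finS by simp
    qed
    have "(\<Sum>I\<in>{I\<in>?I. g I = S}. l ^ card I)
        = l ^ card S * (l + (\<Sum>R\<in>indep_sets E J. l ^ card R))"
      unfolding fibre using notin finite_indep_sets[OF J, of E] Sv finS
      by (simp add: sum.reindex[OF inj] w distrib_left sum_distrib_left)
    moreover have "(\<Sum>I\<in>{I\<in>?I. g I = S}. ?f I)
        = l ^ card S * (D * l + (\<Sum>R\<in>indep_sets E J. real (card R) * l ^ card R))"
    proof -
      have "(\<Sum>I\<in>{I\<in>?I. g I = S}. ?f I) = ?f (insert v S) + (\<Sum>I\<in>(\<union>) S ` indep_sets E J. ?f I)"
        unfolding fibre using notin finite_indep_sets[OF J, of E] by (subst sum.insert) auto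
      also have "(\<Sum>I\<in>(\<union>) S ` indep_sets E J. ?f I) = (\<Sum>R\<in>indep_sets E J. ?f (S \<union> R))"
        by (simp add: sum.reindex[OF inj])
      also have "\<dots> = (\<Sum>R\<in>indep_sets E J. l ^ card S * (real (card R) * l ^ card R))"
        by (rule sum.cong[OF refl f])
      finally show ?thesis unfolding f0 by (simp add: distrib_left sum_distrib_left)
    qed
    moreover have "K * (l + (\<Sum>R\<in>indep_sets E J. l ^ card R))
      \<le> D * l + (\<Sum>R\<in>indep_sets E J. real (card R) * l ^ card R)"
    proof (rule hard_core_occupancy[OF J l sym irr _ lM K L])
      have "card {(x, y). x \<in> J \<and> y \<in> J \<and> E x y}
        \<le> card {(x, y). x \<in> V \<and> y \<in> V \<and> E v x \<and> E v y \<and> E x y}"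
        by (rule card_mono) (auto simp: J_def intro: finite_subset[of _ "V \<times> V"] V)
      then show "real (card {(x, y). x \<in> J \<and> y \<in> J \<and> E x y}) \<le> M" using M by linarith
    qed
    ultimately show ?thesis using l
      by (simp add: mult.left_commute[of K] mult_left_mono)
  qed
  have "K * (\<Sum>I\<in>?I. l ^ card I) = (\<Sum>S\<in>g ` ?I. K * (\<Sum>I\<in>{I\<in>?I. g I = S}. l ^ card I))"
    unfolding sum_distrib_left[symmetric] by (subst sum.image_gen[OF finI, of _ g]) simp
  also have "\<dots> \<le> (\<Sum>S\<in>g ` ?I. \<Sum>I\<in>{I\<in>?I. g I = S}. ?f I)"
    by (rule sum_mono) (rule fib)
  also have "\<dots> = (\<Sum>I\<in>?I. ?f I)" by (rule sum.image_gen[OF finI, symmetric])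
  finally show ?thesis .
qed

text \<open>Sum the local bound over \<open>v\<close>. A member of \<open>I\<close> is counted
  \<open>D\<close> times at itself and once at each of its at most \<open>D\<close> neighbours, so
  \<open>I\<close> receives at most \<open>2 * D * card I\<close>. Some \<open>I\<close> reaches the
  average \<open>K * card V\<close>.\<close>

lemma independent_set_locally_sparse:
  fixes l D K M :: real and E :: "'a \<Rightarrow> 'a \<Rightarrow> bool"
  assumes V: "finite V"
    and sym: "\<And>x y. E x y \<Longrightarrow> E y x" and irr: "\<And>x. \<not> E x x"
    and deg: "\<And>v. v \<in> V \<Longrightarrow> real (card {x\<in>V. E v x}) \<le> D"
    and M: "\<And>v. v \<in> V \<Longrightarrow>
      real (card {(x, y). x \<in> V \<and> y \<in> V \<and> E v x \<and> E v y \<and> E x y}) \<le> M"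
    and l: "l > 0" "l \<le> 1 / 4" "l^2 * M \<le> 1" and K: "K > 0" "2 * K \<le> D"
    and L: "4 * K \<le> ln (D * l / (2 * K))" "4 \<le> ln (D * l / (2 * K))"
  obtains I where "I \<subseteq> V" "\<forall>x\<in>I. \<forall>y\<in>I. \<not> E x y"
    "K * real (card V) \<le> 2 * D * real (card I)"
proof -
  let ?I = "indep_sets E V"
  let ?h = "\<lambda>I. \<Sum>v\<in>V. D * of_bool (v \<in> I) + real (card {x\<in>I. E v x})"
  have finI: "finite ?I" using V by (rule finite_indep_sets)
  have "(\<Sum>I\<in>?I. K * card V * l ^ card I) = (\<Sum>v\<in>V. K * (\<Sum>I\<in>?I. l ^ card I))"
    by (simp add: sum_distrib_left mult_ac)
  also have "\<dots> \<le> (\<Sum>v\<in>V. \<Sum>I\<in>?I. (D * of_bool (v \<in> I) + real (card {x\<in>I. E v x})) * l ^ card I)"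
    by (rule sum_mono)
      (rule hard_core_local_bound[OF V _ l(1,2) sym irr M l(3) K L])
  also have "\<dots> = (\<Sum>I\<in>?I. ?h I * l ^ card I)"
    by (subst sum.swap) (simp add: sum_distrib_right)
  finally have le: "(\<Sum>I\<in>?I. K * card V * l ^ card I) \<le> (\<Sum>I\<in>?I. ?h I * l ^ card I)" .
  have "\<exists>I\<in>?I. K * card V \<le> ?h I"
  proof (rule ccontr)
    assume "\<not> ?thesis"
    then have "?h I * l ^ card I < K * card V * l ^ card I" if "I \<in> ?I" for I
      using that l by (intro mult_strict_right_mono) auto
    then have "(\<Sum>I\<in>?I. ?h I * l ^ card I) < (\<Sum>I\<in>?I. K * card V * l ^ card I)"
      using finI empty_in_indep_sets[of E V] by (intro sum_strict_mono) auto
    then show False using le by linarith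
  qed
  then obtain I where I: "I \<in> ?I" "K * card V \<le> ?h I" by blast
  have IV: "I \<subseteq> V" using I by (simp add: indep_sets_def)
  have finite: "finite I" using IV V by (rule finite_subset)
  have "(\<Sum>v\<in>V. real (card {x\<in>I. E v x})) = real (\<Sum>v\<in>V. card {x\<in>I. E v x})" by simp
  \<comment> \<open>Double counting of the adjacent pairs between \<open>V\<close> and
    \<open>I\<close>.\<close>
  also have "(\<Sum>v\<in>V. card {x\<in>I. E v x}) = (\<Sum>x\<in>I. card {v\<in>V. E v x})"
    using V finite by (rule sum_multicount_gen) auto
  also have "real \<dots> = (\<Sum>x\<in>I. real (card {v\<in>V. E v x}))" by simp
  also have "\<dots> \<le> (\<Sum>x\<in>I. D)"
  proof (rule sum_mono)
    fix x assume "x \<in> I"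
    moreover have "{v\<in>V. E v x} = {v\<in>V. E x v}" using sym by blast
    ultimately show "real (card {v\<in>V. E v x}) \<le> D" using deg IV by auto
  qed
  finally have "(\<Sum>v\<in>V. real (card {x\<in>I. E v x})) \<le> D * card I" by (simp add: mult.commute)
  moreover have "(\<Sum>v\<in>V. D * of_bool (v \<in> I)) = D * card I"
  proof -
    have "V \<inter> I = I" using IV by auto
    then show ?thesis using V by (simp flip: sum_distrib_left)
  qed
  ultimately have "?h I \<le> 2 * D * card I" by (simp add: sum.distrib)
  then show ?thesis using that[of I] I by (auto simp: indep_sets_def)
qed

section \<open>Alignments of words\<close>

text \<open>When \<open>A\<close> is the set of deleted positions, \<open>rank A i\<close> is the
  distance by which a surviving letter \<open>i\<close> moves to the left.\<close>

definition rank :: "nat set \<Rightarrow> nat \<Rightarrow> nat" where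
  "rank A i = card {j\<in>A. j < i}"

lemma rank_le: "rank A i \<le> i"
proof -
  have "card {j\<in>A. j < i} \<le> card {..<i}" by (rule card_mono) auto
  then show ?thesis by (simp add: rank_def)
qed

lemma rank_le_card: "finite A \<Longrightarrow> rank A i \<le> card A"
  unfolding rank_def by (rule card_mono) auto

lemma rank_Suc: "rank A (Suc i) = rank A i + of_bool (i \<in> A)"
proof -
  have "{j\<in>A. j < Suc i} = (if i \<in> A then insert i {j\<in>A. j < i} else {j\<in>A. j < i})"
    by (auto simp: less_Suc_eq)
  then show ?thesis by (simp add: rank_def)
qed

lemma rank_Compl: "rank (- A) i = i - rank A i"
  by (induction i) (use rank_le[of A] in \<open>auto simp: rank_Suc Suc_diff_le\<close>, simp add: rank_def)

lemma rank_const: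
  assumes "{r..<i} \<inter> A = {}" "r \<le> i"
  shows "rank A i = rank A r"
proof -
  have "j < r" if "j \<in> A" "j < i" for j
  proof (rule ccontr)
    assume "\<not> j < r"
    then have "j \<in> {r..<i} \<inter> A" using that by simp
    then show False using assms(1) by simp
  qed
  then have "{j\<in>A. j < i} = {j\<in>A. j < r}" using assms(2) by auto
  then show ?thesis by (simp add: rank_def)
qed

lemma nths_nth_rank:
  assumes "i < length xs" "i \<in> I"
  shows "rank I i < length (nths xs I) \<and> nths xs I ! rank I i = xs ! i"
  using assms(1)
proof (induction xs rule: rev_induct)
  case (snoc x xs)
  show ?case
  proof (cases "i < length xs")
    case True
    then show ?thesis using snoc by (simp add: nths_append nth_append)
  next
    case False
    then have i: "i = length xs" using snoc by simp
    have "rank I i = length (nths xs I)"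
      unfolding rank_def length_nths i by (rule arg_cong[where f = card]) auto
    then show ?thesis using i assms(2) by (simp add: nths_append)
  qed
qed simp

text \<open>The equation on ranks says that both letters land on the same index of the common
  subsequence, \<open>i - rank A i = j - rank B j\<close>, in a form free of truncated
  subtraction.\<close>

lemma aligned_nth_eq:
  assumes "nths u (- A) = nths v (- B)"
    and "i < length u" "j < length v" "i \<notin> A" "j \<notin> B" "i + rank B j = j + rank A i"
  shows "u ! i = v ! j"
proof -
  have "rank (- A) i = rank (- B) j"
    using assms rank_le[of A i] rank_le[of B j] by (simp add: rank_Compl)
  then show ?thesis
    using nths_nth_rank[of i u "- A"] nths_nth_rank[of j v "- B"] assms by simp
qed

text \<open>This is the decoding step of the later counts: a word is recovered from what remains
  after deletion together with the letters at the deleted positions.\<close>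

lemma nths_Compl_inject:
  assumes "length v = length v'" "nths v (- B) = nths v' (- B)" "\<And>j. j \<in> B \<Longrightarrow> v ! j = v' ! j"
  shows "v = v'"
proof (rule nth_equalityI[OF assms(1)])
  fix i assume "i < length v"
  then show "v ! i = v' ! i"
    using assms by (cases "i \<in> B") (auto intro: aligned_nth_eq)
qed

section \<open>Words without long periodic windows\<close>

text \<open>Comparing \<open>h\<close> letters with their translate by \<open>s\<close> involves a
  factor of length \<open>h + s\<close>; what is forbidden is such a factor with period
  \<open>s\<close>.\<close>

definition aperiodic :: "nat \<Rightarrow> nat \<Rightarrow> 'a list \<Rightarrow> bool" where
  "aperiodic S h w \<longleftrightarrow> (\<forall>s j. 1 \<le> s \<and> s \<le> S \<and> j + h + s \<le> length w
     \<longrightarrow> (\<exists>i<h. w ! (j + i) \<noteq> w ! (j + i + s)))"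

lemma card_words: "card (words n) = 2 ^ n"
  using card_lists_length_eq[of "UNIV :: bool set" n] by (simp add: words_def)

text \<open>The \<open>h\<close> letters from position \<open>j\<close> on are redundant: each
  repeats the letter \<open>s\<close> places further right. Erasing them is therefore
  injective.\<close>

lemma card_periodic_window:
  assumes s: "1 \<le> s" "j + h + s \<le> n"
  shows "card {w\<in>words n. \<forall>i<h. w ! (j + i) = w ! (j + i + s)} \<le> 2 ^ (n - h)" (is "card ?P \<le> _")
proof -
  let ?f = "\<lambda>w :: word. take j w @ drop (j + h) w"
  have "inj_on ?f ?P"
  proof (rule inj_onI)
    fix w w' assume w: "w \<in> ?P" and w': "w' \<in> ?P" and eq: "?f w = ?f w'"
    have len: "length w = n" "length w' = n" using w w' by (auto simp: words_def)
    then have eqs: "take j w = take j w'" "drop (j + h) w = drop (j + h) w'"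
      using eq by auto
    \<comment> \<open>The induction runs from the right end, so that letter \<open>i + s\<close> is
      known before letter \<open>i\<close>.\<close>
    have "w ! i = w' ! i" if "i < n" for i
      using that
    proof (induction "n - i" arbitrary: i rule: less_induct)
      case less
      consider "i < j" | "j + h \<le> i" | "j \<le> i" "i < j + h" by linarith
      then show ?case
      proof cases
        case 1 then show ?thesis using eqs(1) by (metis nth_take)
      next
        case 2
        have "drop (j + h) w ! (i - (j + h)) = drop (j + h) w' ! (i - (j + h))"
          using eqs(2) by simp
        then show ?thesis using 2 len less.prems by simp
      next
        case 3
        then have "w ! i = w ! (i + s)" "w' ! i = w' ! (i + s)"
          using w w' by (auto dest!: spec[of _ "i - j"])
        moreover have "w ! (i + s) = w' ! (i + s)" using 3 s by (intro less.hyps) auto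
        ultimately show ?thesis by simp
      qed
    qed
    then show "w = w'" using len by (intro nth_equalityI) auto
  qed
  moreover have "?f ` ?P \<subseteq> words (n - h)" using s by (auto simp: words_def)
  ultimately have "card ?P \<le> card (words (n - h))" using finite_words by (rule card_inj_on_le)
  then show ?thesis by (simp add: card_words)
qed

text \<open>Union bound over the \<open>S\<close> shifts and at most \<open>n\<close> starting
  positions.\<close>

lemma card_not_aperiodic:
  assumes "h \<le> n"
  shows "card {w\<in>words n. \<not> aperiodic S h w} \<le> n * S * 2 ^ (n - h)"
proof -
  let ?P = "\<lambda>(s, j). {w\<in>words n. j + h + s \<le> n \<and> (\<forall>i<h. w ! (j + i) = w ! (j + i + s))}"
  have "card {w\<in>words n. \<not> aperiodic S h w} \<le> card (\<Union>p\<in>{1..S} \<times> {..<n}. ?P p)"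
  proof (rule card_mono)
    show "finite (\<Union>p\<in>{1..S} \<times> {..<n}. ?P p)" using finite_words by auto
    show "{w\<in>words n. \<not> aperiodic S h w} \<subseteq> (\<Union>p\<in>{1..S} \<times> {..<n}. ?P p)"
    proof
      fix w assume "w \<in> {w\<in>words n. \<not> aperiodic S h w}"
      then obtain s j where "1 \<le> s" "s \<le> S" "j + h + s \<le> n"
        "\<forall>i<h. w ! (j + i) = w ! (j + i + s)" "w \<in> words n"
        by (auto simp: aperiodic_def words_def)
      then show "w \<in> (\<Union>p\<in>{1..S} \<times> {..<n}. ?P p)"
        by (intro UN_I[of "(s, j)"]) auto
    qed
  qed
  also have "\<dots> \<le> (\<Sum>p\<in>{1..S} \<times> {..<n}. card (?P p))" by (rule card_UN_le) simp
  also have "\<dots> \<le> (\<Sum>p\<in>{1..S} \<times> {..<n}. 2 ^ (n - h))"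
  proof (rule sum_mono)
    fix p assume p: "p \<in> {1..S} \<times> {..<n}"
    obtain s j where [simp]: "p = (s, j)" by (cases p)
    show "card (?P p) \<le> 2 ^ (n - h)"
    proof (cases "j + h + s \<le> n")
      case True
      then show ?thesis using card_periodic_window[of s j h n] p by simp
    qed simp
  qed
  finally show ?thesis by (simp add: mult_ac)
qed

section \<open>Alignments in a triangle of words\<close>

text \<open>On a block without deletions each alignment is a translation. The route from
  \<open>u\<close> to \<open>w\<close> through \<open>v\<close> and the direct route translate by
  amounts differing by at most \<open>3 * k\<close>; a nonzero difference would give
  \<open>w\<close> a forbidden period. The conclusion equates the two amounts with all subtracted
  terms moved across.\<close>

lemma aligned_shifts_agree:
  assumes len: "length u = n" "length v = n" "length w = n"
    and uv: "nths u (- A) = nths v (- B)" and uw: "nths u (- A') = nths w (- B')"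
    and vw: "nths v (- A'') = nths w (- B'')"
    and bound: "\<And>X. X \<in> {A, B, A', B', A'', B''} \<Longrightarrow> finite X \<and> card X \<le> k"
    and free: "\<And>X. X \<in> {A, B, A', B', A'', B''} \<Longrightarrow> {r..<r + L} \<inter> X = {}"
    and L: "r + L \<le> n" "h + 4 * k \<le> L"
    and ap: "aperiodic (3 * k) h w"
  shows "rank B r + rank B'' r + rank A' r = rank A r + rank A'' r + rank B' r"
proof (rule ccontr)
  assume ne: "\<not> ?thesis"
  have rk: "rank X r \<le> k" if "X \<in> {A, B, A', B', A'', B''}" for X
    using bound[OF that] rank_le_card[of X r] by linarith
  have rks: "rank A r \<le> k" "rank B r \<le> k" "rank A' r \<le> k" "rank B' r \<le> k"
    "rank A'' r \<le> k" "rank B'' r \<le> k" by (auto intro: rk)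
  have const: "rank X i = rank X r" if "X \<in> {A, B, A', B', A'', B''}" "r \<le> i" "i < r + L" for X i
    using free[OF that(1)] that(2,3) by (intro rank_const) (auto simp: disjoint_iff)
  have notin: "i \<notin> X" if "X \<in> {A, B, A', B', A'', B''}" "r \<le> i" "i < r + L" for X i
    using free[OF that(1)] that(2,3) by (auto simp: disjoint_iff)
  \<comment> \<open>Letter \<open>r + 2 * k + t\<close> of \<open>u\<close> goes to letter \<open>m + t\<close> of \<open>w\<close> through \<open>v\<close>, and to \<open>m' + t\<close> directly.\<close>
  define m where "m = r + 2 * k + rank B r + rank B'' r - rank A r - rank A'' r"
  define m' where "m' = r + 2 * k + rank B' r - rank A' r"
  have eq: "w ! (m + t) = w ! (m' + t)" if t: "t < h" for t
  proof -
    define i where "i = r + 2 * k + t"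
    define j where "j = i + rank B r - rank A r"
    have ij: "i + rank B r = j + rank A r" "j + rank B'' r = m + t + rank A'' r"
      "i + rank B' r = m' + t + rank A' r"
      using rks unfolding i_def j_def m_def m'_def by linarith+
    \<comment> \<open>Starting \<open>2 * k\<close> inside the block leaves room for two
      translations by at most \<open>k\<close> in either direction; this uses
      \<open>h + 4 * k \<le> L\<close>.\<close>
    have i: "r \<le> i" "i < r + L" and j: "r \<le> j" "j < r + L"
      and m: "r \<le> m + t" "m + t < r + L" and m': "r \<le> m' + t" "m' + t < r + L"
      using t L rks ij unfolding i_def by linarith+
    have "u ! i = v ! j"
      using i j L len ij(1) const[of A, OF _ i] const[of B, OF _ j] notin[of A, OF _ i] notin[of B, OF _ j]
      by (intro aligned_nth_eq[OF uv]) simp_all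
    moreover have "v ! j = w ! (m + t)"
      using j m L len ij(2) const[of A'', OF _ j] const[of B'', OF _ m]
        notin[of A'', OF _ j] notin[of B'', OF _ m]
      by (intro aligned_nth_eq[OF vw]) simp_all
    moreover have "u ! i = w ! (m' + t)"
      using i m' L len ij(3) const[of A', OF _ i] const[of B', OF _ m']
        notin[of A', OF _ i] notin[of B', OF _ m']
      by (intro aligned_nth_eq[OF uw]) simp_all
    ultimately show ?thesis by simp
  qed
  have mm: "m \<noteq> m'" using ne rks unfolding m_def m'_def by linarith
  have bd: "m \<le> m' + 3 * k" "m' \<le> m + 3 * k" "m + h \<le> n" "m' + h \<le> n"
    using rks L unfolding m_def m'_def by linarith+
  show False
  proof (cases "m < m'")
    case True
    then have "1 \<le> m' - m \<and> m' - m \<le> 3 * k \<and> m + h + (m' - m) \<le> length w"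
      using bd len by linarith
    then obtain t where "t < h" "w ! (m + t) \<noteq> w ! (m + t + (m' - m))"
      using ap[unfolded aperiodic_def, rule_format, of "m' - m" m] by blast
    moreover have "m + t + (m' - m) = m' + t" using True by simp
    ultimately show False using eq by simp
  next
    case False
    then have "1 \<le> m - m' \<and> m - m' \<le> 3 * k \<and> m' + h + (m - m') \<le> length w"
      using bd len mm by linarith
    then obtain t where "t < h" "w ! (m' + t) \<noteq> w ! (m' + t + (m - m'))"
      using ap[unfolded aperiodic_def, rule_format, of "m - m'" m'] by blast
    moreover have "m' + t + (m - m') = m + t" using False by simp
    ultimately show False using eq by simp
  qed
qed

text \<open>The closed neighbourhoods of radius \<open>g\<close> around the entries are disjoint and
  lie inside a word of length \<open>n\<close>. Indices are compared rather than values, so a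
  repeated entry destroys separation.\<close>

definition separated :: "nat \<Rightarrow> nat \<Rightarrow> nat list \<Rightarrow> bool" where
  "separated n g xs \<longleftrightarrow> (\<forall>s<length xs. g \<le> xs ! s \<and> xs ! s + 1 + g \<le> n
    \<and> (\<forall>t<length xs. s \<noteq> t \<longrightarrow> xs ! s + 2 * g < xs ! t \<or> xs ! t + 2 * g < xs ! s))"

text \<open>Some \<open>p\<close> among the \<open>4 * k\<close> positions is far from every
  deletion between \<open>v\<close> and \<open>w\<close>. The two routes from \<open>u\<close> to
  \<open>w\<close> agree just left and just right of \<open>p\<close>, yet crossing \<open>p\<close>
  changes exactly one of the four ranks of \<open>a\<close>, \<open>b\<close>, \<open>a'\<close>,
  \<open>b'\<close>, which breaks the equality.\<close>

lemma separated_triangle_False: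
  assumes len: "length u = n" "length v = n" "length w = n"
    and k: "k > 0" "length a = k" "length b = k" "length a' = k" "length b' = k"
      "length a'' = k" "length b'' = k"
    and uv: "nths u (- set a) = nths v (- set b)" and uw: "nths u (- set a') = nths w (- set b')"
    and vw: "nths v (- set a'') = nths w (- set b'')"
    and sep: "separated n g (a @ b @ a' @ b')" and g: "h + 4 * k \<le> g"
    and ap: "aperiodic (3 * k) h w"
  shows False
proof -
  define xs where "xs = a @ b @ a' @ b'"
  have lxs: "length xs = 4 * k" using k by (simp add: xs_def)
  \<comment> \<open>Pigeonhole: a position of \<open>a''\<close> or \<open>b''\<close> is within
    \<open>g\<close> of at most one separated entry, and there are at most \<open>2 * k\<close> such
    positions for \<open>4 * k\<close> entries.\<close>
  have "\<exists>s<4 * k. \<forall>x\<in>set a'' \<union> set b''. \<not> (xs ! s \<le> x + g \<and> x \<le> xs ! s + g)"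
  proof (rule ccontr)
    assume "\<not> ?thesis"
    then have "\<exists>f. \<forall>s\<in>{..<4 * k}. f s \<in> set a'' \<union> set b'' \<and> xs ! s \<le> f s + g \<and> f s \<le> xs ! s + g"
      by (intro bchoice) auto
    then obtain f where f: "\<forall>s\<in>{..<4 * k}. f s \<in> set a'' \<union> set b'' \<and> xs ! s \<le> f s + g \<and> f s \<le> xs ! s + g"
      by blast
    have "inj_on f {..<4 * k}"
    proof (rule inj_onI, rule ccontr)
      fix s t assume *: "s \<in> {..<4 * k}" "t \<in> {..<4 * k}" "f s = f t" "s \<noteq> t"
      then have "xs ! s + 2 * g < xs ! t \<or> xs ! t + 2 * g < xs ! s"
        using sep lxs unfolding separated_def xs_def[symmetric] by auto
      then show False using f[THEN bspec, OF *(1)] f[THEN bspec, OF *(2)] *(3) by linarith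
    qed
    then have "card {..<4 * k} \<le> card (set a'' \<union> set b'')"
      using f by (intro card_inj_on_le) auto
    also have "\<dots> \<le> card (set a'') + card (set b'')" by (rule card_Un_le)
    also have "\<dots> \<le> k + k" using k card_length[of a''] card_length[of b''] by linarith
    finally show False using k by simp
  qed
  then obtain s where s: "s < 4 * k"
    and s'': "\<And>x. x \<in> set a'' \<union> set b'' \<Longrightarrow> x + g < xs ! s \<or> xs ! s + g < x"
    by (auto simp: not_le)
  define p where "p = xs ! s"
  have p: "g \<le> p" "p + 1 + g \<le> n"
    using sep s lxs unfolding separated_def xs_def[symmetric] p_def by auto
  have far: "xs ! t + 2 * g < p \<or> p + 2 * g < xs ! t" if "t < 4 * k" "t \<noteq> s" for t
    using sep s lxs that unfolding separated_def xs_def[symmetric] p_def by metis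
  let ?Xs = "{set a, set b, set a', set b', set a'', set b''}"
  have iso: "x + g < p \<or> p + g < x" if "X \<in> ?Xs" "x \<in> X" "x \<noteq> p" for x X
  proof (cases "x \<in> set a'' \<union> set b''")
    case True then show ?thesis using s''[of x] by (simp add: p_def)
  next
    case False
    then have "x \<in> set xs" using that by (auto simp: xs_def)
    then obtain t where "t < 4 * k" "x = xs ! t" using lxs by (auto simp: in_set_conv_nth)
    then show ?thesis using far[of t] that(3) by (cases "t = s") (auto simp: p_def)
  qed
  have bound: "finite X \<and> card X \<le> k" if "X \<in> ?Xs" for X
    using that k card_length[of a] card_length[of b] card_length[of a'] card_length[of b']
      card_length[of a''] card_length[of b''] by auto
  \<comment> \<open>The two deletion-free blocks end just before \<open>p\<close> and start just
    after it, so \<open>p\<close> is the only possible deletion between their starting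
    points.\<close>
  have free1: "{p - g..<(p - g) + g} \<inter> X = {}" if "X \<in> ?Xs" for X
    using iso[OF that] p by fastforce
  have free2: "{p + 1..<(p + 1) + g} \<inter> X = {}" if "X \<in> ?Xs" for X
    using iso[OF that] p by fastforce
  have left: "rank (set b) (p - g) + rank (set b'') (p - g) + rank (set a') (p - g)
      = rank (set a) (p - g) + rank (set a'') (p - g) + rank (set b') (p - g)"
    by (rule aligned_shifts_agree[OF len uv uw vw bound free1 _ g ap]) (use p in auto)
  have right: "rank (set b) (p + 1) + rank (set b'') (p + 1) + rank (set a') (p + 1)
      = rank (set a) (p + 1) + rank (set a'') (p + 1) + rank (set b') (p + 1)"
    by (rule aligned_shifts_agree[OF len uv uw vw bound free2 _ g ap]) (use p in auto)
  have step: "rank X (p + 1) = rank X (p - g) + of_bool (p \<in> X)" if "X \<in> ?Xs" for X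
    using rank_const[of "p - g" p X] free1[OF that] p by (simp add: rank_Suc)
  have "p \<notin> set a''" "p \<notin> set b''" using s''[of p] by (auto simp: p_def)
  \<comment> \<open>Subtracting the identity on the left from the one on the right leaves only the
    jumps at \<open>p\<close>.\<close>
  then have jumps: "of_bool (p \<in> set b) + of_bool (p \<in> set a')
      = (of_bool (p \<in> set a) + of_bool (p \<in> set b') :: nat)"
    using left right step[of "set a"] step[of "set b"] step[of "set a'"] step[of "set b'"]
      step[of "set a''"] step[of "set b''"] by simp
  \<comment> \<open>Separation makes \<open>s\<close> the only index of \<open>p\<close> in the
    concatenation, so \<open>p\<close> belongs to exactly one of the four lists.\<close>
  have mem: "p \<in> set a \<longleftrightarrow> s < k" "p \<in> set b \<longleftrightarrow> k \<le> s \<and> s < 2 * k"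
    "p \<in> set a' \<longleftrightarrow> 2 * k \<le> s \<and> s < 3 * k" "p \<in> set b' \<longleftrightarrow> 3 * k \<le> s"
  proof -
    have idx: "p = xs ! t \<longleftrightarrow> t = s" if "t < 4 * k" for t
      using far[OF that] by (cases "t = s") (auto simp: p_def)
    have nth: "a ! i = xs ! i" "b ! i = xs ! (k + i)" "a' ! i = xs ! (2 * k + i)" "b' ! i = xs ! (3 * k + i)"
      if "i < k" for i using that k by (auto simp: xs_def nth_append)
    have *: "p = a ! i \<longleftrightarrow> s = i" "p = b ! i \<longleftrightarrow> s = k + i" "p = a' ! i \<longleftrightarrow> s = 2 * k + i"
      "p = b' ! i \<longleftrightarrow> s = 3 * k + i" if "i < k" for i
      unfolding nth[OF that] using that by (subst idx; simp add: eq_commute)+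
    have set: "p \<in> set c \<longleftrightarrow> (\<exists>i<k. p = c ! i)" if "length c = k" for c
      unfolding in_set_conv_nth that by (simp only: eq_commute)
    have shift: "(\<exists>i<k. s = l + i) \<longleftrightarrow> l \<le> s \<and> s < l + k" for l
      by (auto intro!: exI[of _ "s - l"])
    show "p \<in> set a \<longleftrightarrow> s < k" 
      using *(1) by (simp add: set[OF k(2)] cong: conj_cong)
    show "p \<in> set b \<longleftrightarrow> k \<le> s \<and> s < 2 * k" 
      using *(2) shift[of k] by (simp add: set[OF k(3)] mult_2 cong: conj_cong)
    show "p \<in> set a' \<longleftrightarrow> 2 * k \<le> s \<and> s < 3 * k" 
      using *(3) shift[of "2 * k"] by (simp add: set[OF k(4)] cong: conj_cong)
    show "p \<in> set b' \<longleftrightarrow> 3 * k \<le> s" 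
      using *(4) shift[of "3 * k"] s by (simp add: set[OF k(5)] cong: conj_cong)
  qed
  show False using jumps s unfolding mem by (auto simp: of_bool_def split: if_splits)
qed

section \<open>Counting lists that are not separated\<close>

text \<open>Coordinate \<open>t\<close> is replaced by the number \<open>c xs\<close>, which takes
  only \<open>C\<close> values; this trades one factor \<open>n\<close> for
  \<open>C\<close>.\<close>

lemma card_lists_determined_coordinate:
  assumes t: "t < m" and S: "\<And>xs. xs \<in> S \<Longrightarrow> set xs \<subseteq> {..<n} \<and> length xs = m \<and> c xs < C"
    and inj: "\<And>xs ys. \<lbrakk>xs \<in> S; ys \<in> S; \<And>i. i < m \<Longrightarrow> i \<noteq> t \<Longrightarrow> xs ! i = ys ! i; c xs = c ys\<rbrakk>
       \<Longrightarrow> xs ! t = ys ! t"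
  shows "card S \<le> n ^ (m - 1) * (C :: nat)"
proof -
  let ?f = "\<lambda>xs. (take t xs @ drop (Suc t) xs, c xs)"
  let ?T = "{xs. set xs \<subseteq> {..<n} \<and> length xs = m - 1} \<times> {..<C}"
  have "inj_on ?f S"
  proof (rule inj_onI)
    fix xs ys assume xs: "xs \<in> S" and ys: "ys \<in> S" and eq: "?f xs = ?f ys"
    have len: "length xs = m" "length ys = m" using S xs ys by auto
    have eqs: "take t xs = take t ys" "drop (Suc t) xs = drop (Suc t) ys" "c xs = c ys"
      using eq len by auto
    have *: "xs ! i = ys ! i" if "i < m" "i \<noteq> t" for i
    proof (cases "i < t")
      case True then show ?thesis using eqs(1) by (metis nth_take)
    next
      case False
      then have "i = Suc t + (i - Suc t)" using that by simp
      then show ?thesis using eqs(2) len that t by (metis Suc_leI nth_drop)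
    qed
    have "xs ! t = ys ! t" using xs ys * eqs(3) by (rule inj)
    then show "xs = ys" using * len by (intro nth_equalityI) metis+
  qed
  moreover have "?f ` S \<subseteq> ?T"
  proof
    fix y assume "y \<in> ?f ` S"
    then obtain xs where xs: "xs \<in> S" "y = ?f xs" by blast
    have "set (take t xs) \<subseteq> {..<n}" "set (drop (Suc t) xs) \<subseteq> {..<n}"
      using S[OF xs(1)] set_take_subset[of t xs] set_drop_subset[of "Suc t" xs] by auto
    then show "y \<in> ?T" using xs S[OF xs(1)] t by auto
  qed
  moreover have "finite ?T" by (intro finite_cartesian_product finite_lists_length_eq) auto
  ultimately have "card S \<le> card ?T" by (rule card_inj_on_le)
  then show ?thesis by (simp add: card_cartesian_product card_lists_length_eq)
qed

text \<open>Separation fails through a close pair of entries or through an entry near an end. In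
  each case one coordinate is determined by the others up to \<open>O(g)\<close> choices.\<close>

lemma card_not_separated:
  "card {xs. set xs \<subseteq> {..<n} \<and> length xs = m \<and> \<not> separated n g xs}
     \<le> n ^ (m - 1) * (m * m * (4 * g + 1) + m * (2 * g + 1))" (is "card ?N \<le> _")
proof -
  let ?U = "{xs. set xs \<subseteq> {..<n} \<and> length xs = m}"
  let ?A = "\<lambda>(s, t). {xs\<in>?U. s \<noteq> t \<and> xs ! s \<le> xs ! t + 2 * g \<and> xs ! t \<le> xs ! s + 2 * g}"
  let ?B = "\<lambda>s. {xs\<in>?U. xs ! s < g}"
  let ?C = "\<lambda>s. {xs\<in>?U. n < xs ! s + 1 + g}"
  let ?P = "{..<m} \<times> {..<m}"
  have finU: "finite ?U" by (intro finite_lists_length_eq) auto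
  have "card ?N \<le> card ((\<Union>p\<in>?P. ?A p) \<union> (\<Union>s\<in>{..<m}. ?B s) \<union> (\<Union>s\<in>{..<m}. ?C s))"
  proof (rule card_mono)
    show "finite ((\<Union>p\<in>?P. ?A p) \<union> (\<Union>s\<in>{..<m}. ?B s) \<union> (\<Union>s\<in>{..<m}. ?C s))"
      by (rule finite_subset[OF _ finU]) auto
    show "?N \<subseteq> (\<Union>p\<in>?P. ?A p) \<union> (\<Union>s\<in>{..<m}. ?B s) \<union> (\<Union>s\<in>{..<m}. ?C s)"
    proof
      fix xs assume xs: "xs \<in> ?N"
      then obtain s where s: "s < m" and
        cs: "xs ! s < g \<or> n < xs ! s + 1 + g \<or>
          (\<exists>t<m. s \<noteq> t \<and> xs ! t \<le> xs ! s + 2 * g \<and> xs ! s \<le> xs ! t + 2 * g)"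
        unfolding separated_def by (auto simp: not_le not_less)
      show "xs \<in> (\<Union>p\<in>?P. ?A p) \<union> (\<Union>s\<in>{..<m}. ?B s) \<union> (\<Union>s\<in>{..<m}. ?C s)"
      proof (cases "xs ! s < g \<or> n < xs ! s + 1 + g")
        case True
        then show ?thesis using xs s by blast
      next
        case False
        then obtain t where t: "t < m" "s \<noteq> t" "xs ! t \<le> xs ! s + 2 * g" "xs ! s \<le> xs ! t + 2 * g"
          using cs by blast
        then have "xs \<in> ?A (s, t)" using xs by simp
        then show ?thesis using s t(1) by blast
      qed
    qed
  qed
  also have "\<dots> \<le> card (\<Union>p\<in>?P. ?A p) + card (\<Union>s\<in>{..<m}. ?B s) + card (\<Union>s\<in>{..<m}. ?C s)"
    by (meson add_mono card_Un_le le_trans order_refl)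
  also have "card (\<Union>p\<in>?P. ?A p) \<le> card ?P * (n ^ (m - 1) * (4 * g + 1))"
  proof (rule card_UN_le[THEN order_trans])
    have "card (?A p) \<le> n ^ (m - 1) * (4 * g + 1)" if "p \<in> ?P" for p
    proof -
      obtain s t where [simp]: "p = (s, t)" by (cases p)
      \<comment> \<open>Adding \<open>2 * g\<close> makes the difference of two close entries a
        natural number from 0 to \<open>4 * g\<close>, without truncation.\<close>
      show ?thesis
      proof (rule card_lists_determined_coordinate[where t = s and c = "\<lambda>xs. xs ! s + 2 * g - xs ! t"])
        fix xs ys assume "xs \<in> ?A p" "ys \<in> ?A p" and i: "\<And>i. i < m \<Longrightarrow> i \<noteq> s \<Longrightarrow> xs ! i = ys ! i"
          and c: "xs ! s + 2 * g - xs ! t = ys ! s + 2 * g - ys ! t"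
        moreover from this have "xs ! t = ys ! t" using that by (intro i) auto
        ultimately show "xs ! s = ys ! s" by auto
      qed (use that in auto)
    qed
    then have "(\<Sum>p\<in>?P. card (?A p)) \<le> (\<Sum>p\<in>?P. n ^ (m - 1) * (4 * g + 1))" by (rule sum_mono)
    then show "(\<Sum>p\<in>?P. card (?A p)) \<le> card ?P * (n ^ (m - 1) * (4 * g + 1))" by simp
  qed simp
  also have "card (\<Union>s\<in>{..<m}. ?B s) \<le> m * (n ^ (m - 1) * g)"
  proof (rule card_UN_le[THEN order_trans])
    have "card (?B s) \<le> n ^ (m - 1) * g" if "s \<in> {..<m}" for s
      by (rule card_lists_determined_coordinate[where t = s and c = "\<lambda>xs. xs ! s"]) (use that in auto)
    then have "(\<Sum>s<m. card (?B s)) \<le> (\<Sum>s<m. n ^ (m - 1) * g)" by (rule sum_mono)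
    then show "(\<Sum>s<m. card (?B s)) \<le> m * (n ^ (m - 1) * g)" by simp
  qed simp
  also have "card (\<Union>s\<in>{..<m}. ?C s) \<le> m * (n ^ (m - 1) * (g + 1))"
  proof (rule card_UN_le[THEN order_trans])
    have "card (?C s) \<le> n ^ (m - 1) * (g + 1)" if "s \<in> {..<m}" for s
    proof (rule card_lists_determined_coordinate[where t = s and c = "\<lambda>xs. n - xs ! s"])
      fix xs ys assume "xs \<in> ?C s" "ys \<in> ?C s" "n - xs ! s = n - ys ! s"
      moreover from this have "xs ! s < n" "ys ! s < n"
        using that by (auto dest!: nth_mem)
      ultimately show "xs ! s = ys ! s" by auto
    qed (use that in auto)
    then have "(\<Sum>s<m. card (?C s)) \<le> (\<Sum>s<m. n ^ (m - 1) * (g + 1))" by (rule sum_mono)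
    then show "(\<Sum>s<m. card (?C s)) \<le> m * (n ^ (m - 1) * (g + 1))" by simp
  qed simp
  finally show ?thesis by (simp add: algebra_simps)
qed

section \<open>The deletion graph\<close>

text \<open>Codes are attached by a relation, since a word may have many alignments and none is
  canonical; it suffices that no code serves two objects.\<close>

lemma card_le_by_codes:
  assumes "finite C" "\<And>v. v \<in> S \<Longrightarrow> \<exists>c\<in>C. R v c"
    and "\<And>v v' c. \<lbrakk>v \<in> S; v' \<in> S; R v c; R v' c\<rbrakk> \<Longrightarrow> v = v'"
  shows "card S \<le> card C"
proof -
  obtain f where f: "\<forall>v\<in>S. f v \<in> C \<and> R v (f v)"
    using bchoice[of S "\<lambda>v c. c \<in> C \<and> R v c"] assms(2) by blast
  have "inj_on f S" using f assms(3) by (metis (no_types, lifting) inj_onI)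
  then show ?thesis using f assms(1) by (intro card_inj_on_le[of f]) auto
qed

lemma LCS_commute: "LCS u v = LCS v u"
  unfolding LCS_def by (simp add: conj_commute)

text \<open>Deleted positions are listed rather than kept as a set, so that alignments are counted
  by lists of fixed length.\<close>

lemma nths_Compl_of_subseq:
  assumes "subseq z u" "length z + k = length u"
  obtains a where "length a = k" "set a \<subseteq> {..<length u}" "nths u (- set a) = z"
proof -
  obtain N where N: "z = nths u N" using assms(1) by (auto simp: subseq_conv_nths)
  define A where "A = {..<length u} - N"
  have eq: "nths u (- A) = z"
    unfolding N nths_def
    by (rule arg_cong[where f = "map fst"], rule filter_cong) (auto simp: A_def dest: set_zip_rightD)
  have "length z + card A = length u"
  proof -
    have "card {i. i < length u \<and> i \<in> N} + card A = card ({i. i < length u \<and> i \<in> N} \<union> A)"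
      by (rule card_Un_disjoint[symmetric]) (auto simp: A_def)
    also have "{i. i < length u \<and> i \<in> N} \<union> A = {..<length u}" by (auto simp: A_def)
    finally show ?thesis by (simp add: N length_nths)
  qed
  then have "card A = k" using assms(2) by simp
  moreover obtain a where "set a = A" "distinct a"
    using finite_distinct_list[of A] by (auto simp: A_def)
  ultimately show ?thesis using that[of a] eq distinct_card[of a] by (auto simp: A_def)
qed

text \<open>A longest common subsequence has length at least \<open>n - k\<close>; cutting it to
  exactly \<open>n - k\<close> leaves \<open>k\<close> deletions in each word.\<close>

lemma common_nths_of_deletion_distance:
  assumes "length u = n" "length v = n" "k \<le> n" "deletion_distance u v \<le> k"
  obtains a b where "length a = k" "set a \<subseteq> {..<n}" "length b = k" "set b \<subseteq> {..<n}"
    "nths u (- set a) = nths v (- set b)"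
proof -
  have "LCS u v \<in> {length w | w. subseq w u \<and> subseq w v}"
    unfolding LCS_def by (rule Max_in) (rule common_subseq_lengths)+
  then obtain z where z: "subseq z u" "subseq z v" "length z = LCS u v" by auto
  let ?z = "take (n - k) z"
  have "length ?z + k = n" using z assms by (simp add: deletion_distance_def)
  moreover have "subseq ?z z" by (metis append_take_drop_id list_emb_append2 list_emb_refl prefix_imp_subseq take_is_prefix)
  ultimately have "subseq ?z u" "subseq ?z v" "length ?z + k = length u" "length ?z + k = length v"
    using z assms by (auto intro: subseq_order.trans)
  then show ?thesis using that assms by (metis nths_Compl_of_subseq)
qed

text \<open>A neighbour \<open>v\<close> is encoded by the two lists of \<open>k\<close> deleted
  positions and the \<open>k\<close> letters of \<open>v\<close> at its own deleted
  positions.\<close>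

lemma card_deletion_ball:
  assumes u: "length u = n" and k: "k \<le> n"
  shows "card {v\<in>words n. deletion_distance u v \<le> k} \<le> 2 ^ k * n ^ (2 * k)"
proof -
  let ?L = "{xs. set xs \<subseteq> {..<n} \<and> length xs = k}" and ?B = "{xs :: bool list. set xs \<subseteq> UNIV \<and> length xs = k}"
  let ?C = "(?L \<times> ?L) \<times> ?B"
  have "card {v\<in>words n. deletion_distance u v \<le> k} \<le> card ?C"
  proof (rule card_le_by_codes[where R =
      "\<lambda>v ((a, b), c). nths u (- set a) = nths v (- set b) \<and> c = map ((!) v) b"])
    show "finite ?C" by (intro finite_cartesian_product finite_lists_length_eq) auto
  next
    fix v assume "v \<in> {v\<in>words n. deletion_distance u v \<le> k}"
    then obtain a b where "length a = k" "set a \<subseteq> {..<n}" "length b = k" "set b \<subseteq> {..<n}"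
      "nths u (- set a) = nths v (- set b)"
      using common_nths_of_deletion_distance[OF u _ k, of v] by (auto simp: words_def)
    then show "\<exists>c\<in>?C. (\<lambda>((a, b), c). nths u (- set a) = nths v (- set b) \<and> c = map ((!) v) b) c"
      by (intro bexI[of _ "((a, b), map ((!) v) b)"]) auto
  next
    fix v v' c
    assume "v \<in> {v\<in>words n. deletion_distance u v \<le> k}" "v' \<in> {v\<in>words n. deletion_distance u v \<le> k}"
      and R: "(\<lambda>((a, b), c). nths u (- set a) = nths v (- set b) \<and> c = map ((!) v) b) c"
      "(\<lambda>((a, b), c). nths u (- set a) = nths v' (- set b) \<and> c = map ((!) v') b) c"
    then have len: "length v = length v'" by (simp add: words_def)
    obtain a b bs where "c = ((a, b), bs)" by (metis prod.collapse)
    then have *: "nths v (- set b) = nths v' (- set b)" "map ((!) v) b = map ((!) v') b"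
      using R by simp_all
    show "v = v'"
      by (rule nths_Compl_inject[OF len *(1)]) (use *(2) in \<open>simp add: map_eq_conv\<close>)
  qed
  also have "\<dots> = 2 ^ k * n ^ (2 * k)"
  proof -
    have L: "card ?L = n ^ k" using card_lists_length_eq[of "{..<n}" k] by simp
    have B: "card ?B = 2 ^ k" using card_lists_length_eq[of "UNIV :: bool set" k] by simp
    have "card ?C = n ^ k * n ^ k * 2 ^ k" unfolding card_cartesian_product L B ..
    also have "n ^ k * n ^ k = n ^ (2 * k)" by (simp only: mult_2 power_add)
    finally show ?thesis by (simp only: mult.commute)
  qed
  finally show ?thesis .
qed

text \<open>The pair \<open>(v, w)\<close> is encoded by its \<open>4 * k\<close> positions of
  deletion against \<open>u\<close> and by \<open>2 * k\<close> letters. The list of positions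
  cannot be separated, which lowers the exponent of \<open>n\<close> from \<open>4 * k\<close> to
  \<open>4 * k - 1\<close> at the price of a factor linear in \<open>g\<close>.\<close>

lemma card_deletion_triangles:
  assumes u: "length u = n" and k: "0 < k" "k \<le> n" and g: "h + 4 * k \<le> g"
  shows "card {(v, w). v \<in> words n \<and> w \<in> words n \<and> aperiodic (3 * k) h w \<and>
      deletion_distance u v \<le> k \<and> deletion_distance u w \<le> k \<and> deletion_distance v w \<le> k}
    \<le> 4 ^ k * (n ^ (4 * k - 1) * (4 * k * (4 * k) * (4 * g + 1) + 4 * k * (2 * g + 1)))"
    (is "card ?S \<le> _")
proof -
  let ?L = "{xs. set xs \<subseteq> {..<n} \<and> length xs = 4 * k \<and> \<not> separated n g xs}"
  let ?B = "{xs :: bool list. set xs \<subseteq> UNIV \<and> length xs = 2 * k}"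
  define R where "R = (\<lambda>(v :: word, w :: word) (xs, c). \<exists>a b a' b'.
     length a = k \<and> length b = k \<and> length a' = k \<and> length b' = k \<and> xs = a @ b @ a' @ b' \<and>
     nths u (- set a) = nths v (- set b) \<and> nths u (- set a') = nths w (- set b') \<and>
     c = map ((!) v) b @ map ((!) w) b')"
  have "card ?S \<le> card (?L \<times> ?B)"
  proof (rule card_le_by_codes[where R = R])
    have "finite ?L"
      by (rule finite_subset[OF _ finite_lists_length_eq[of "{..<n}" "4 * k"]]) auto
    then show "finite (?L \<times> ?B)" by (intro finite_cartesian_product finite_lists_length_eq) auto
  next
    fix p assume "p \<in> ?S"
    then obtain v w where p: "p = (v, w)" and len: "length v = n" "length w = n"
      and ap: "aperiodic (3 * k) h w" and d: "deletion_distance u v \<le> k"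
        "deletion_distance u w \<le> k" "deletion_distance v w \<le> k"
      by (auto simp: words_def)
    obtain a b where ab: "length a = k" "set a \<subseteq> {..<n}" "length b = k" "set b \<subseteq> {..<n}"
      "nths u (- set a) = nths v (- set b)"
      using common_nths_of_deletion_distance[OF u len(1) k(2) d(1)] by blast
    obtain a' b' where ab': "length a' = k" "set a' \<subseteq> {..<n}" "length b' = k" "set b' \<subseteq> {..<n}"
      "nths u (- set a') = nths w (- set b')"
      using common_nths_of_deletion_distance[OF u len(2) k(2) d(2)] by blast
    obtain a'' b'' where ab'': "length a'' = k" "length b'' = k"
      "nths v (- set a'') = nths w (- set b'')"
      using common_nths_of_deletion_distance[OF len k(2) d(3)] by blast
    have "\<not> separated n g (a @ b @ a' @ b')"
      using separated_triangle_False[OF u len k(1) ab(1,3) ab'(1,3) ab''(1,2) ab(5) ab'(5) ab''(3) _ g ap]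
      by blast
    then show "\<exists>c\<in>?L \<times> ?B. R p c"
      using ab ab' unfolding p R_def
      by (intro bexI[of _ "(a @ b @ a' @ b', map ((!) v) b @ map ((!) w) b')"]) auto
  next
    fix p q c assume pq: "p \<in> ?S" "q \<in> ?S" and R: "R p c" "R q c"
    obtain v w v' w' xs bs where [simp]: "p = (v, w)" "q = (v', w')" "c = (xs, bs)"
      by (cases p, cases q, cases c)
    obtain a b a' b' where *: "length a = k" "length b = k" "length a' = k" "length b' = k"
      "xs = a @ b @ a' @ b'" "nths u (- set a) = nths v (- set b)"
      "nths u (- set a') = nths w (- set b')" "bs = map ((!) v) b @ map ((!) w) b'"
      using R(1) by (auto simp: R_def)
    have **: "nths u (- set a) = nths v' (- set b)" "nths u (- set a') = nths w' (- set b')"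
      "bs = map ((!) v') b @ map ((!) w') b'"
    \<comment> \<open>All pieces have length \<open>k\<close>, so \<open>xs\<close> splits in only
      one way and both pairs were encoded by the same four lists.\<close>
    proof -
      obtain a2 b2 a2' b2' where 2: "length a2 = k" "length b2 = k" "length a2' = k" "length b2' = k"
        "xs = a2 @ b2 @ a2' @ b2'" "nths u (- set a2) = nths v' (- set b2)"
        "nths u (- set a2') = nths w' (- set b2')" "bs = map ((!) v') b2 @ map ((!) w') b2'"
        using R(2) by (auto simp: R_def)
      have "a @ b @ a' @ b' = a2 @ b2 @ a2' @ b2'" using *(5) 2(5) by (rule trans[OF sym])
      then have "a2 = a" "b2 = b" "a2' = a'" "b2' = b'"
        using *(1-4) 2(1-4) by simp_all
      then show "nths u (- set a) = nths v' (- set b)" "nths u (- set a') = nths w' (- set b')"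
        "bs = map ((!) v') b @ map ((!) w') b'"
        using 2(6-8) by simp_all
    qed
    have "v = v'"
      using pq * ** by (intro nths_Compl_inject[of v v' "set b"]) (auto simp: words_def map_eq_conv)
    moreover have "w = w'"
      using pq * ** by (intro nths_Compl_inject[of w w' "set b'"]) (auto simp: words_def map_eq_conv)
    ultimately show "p = q" by simp
  qed
  also have "\<dots> = card ?L * 4 ^ k"
  proof -
    have "card ?B = 2 ^ (2 * k)"
      using card_lists_length_eq[of "UNIV :: bool set" "2 * k"] by simp
    also have "\<dots> = (2 ^ 2) ^ k" by (rule power_mult)
    finally show ?thesis by (simp only: card_cartesian_product) simp
  qed
  also have "\<dots> \<le> (n ^ (4 * k - 1) * (4 * k * (4 * k) * (4 * g + 1) + 4 * k * (2 * g + 1))) * 4 ^ k"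
    by (rule mult_right_mono[OF card_not_separated]) simp
  finally show ?thesis by (simp only: mult.commute)
qed

section \<open>Codes as independent sets\<close>

lemma card_le_max_code_size: "deletion_code n k C \<Longrightarrow> card C \<le> max_code_size n k"
  unfolding max_code_size_def by (rule Max_ge[OF code_sizes(1)]) blast

lemma max_code_size_pos: "max_code_size n k \<ge> 1"
  using card_le_max_code_size[of n k "{replicate n False}"] by (simp add: deletion_code_def words_def)

text \<open>The graph theorem is applied to the aperiodic words. They make up at least half of all
  words, which is why \<open>4 * D\<close> stands here in place of \<open>2 * D\<close>.\<close>

lemma max_code_size_ge_hard_core:
  fixes l K :: real
  assumes k: "0 < k" "k \<le> n" and h: "h \<le> n" "6 * k * n \<le> 2 ^ h"
    and l: "l > 0" "l \<le> 1 / 4"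
      "l\<^sup>2 * real (4 ^ k * (n ^ (4 * k - 1) *
         (4 * k * (4 * k) * (4 * (h + 4 * k) + 1) + 4 * k * (2 * (h + 4 * k) + 1)))) \<le> 1"
    and D: "D = 2 ^ k * real n ^ (2 * k)"
    and K: "K > 0" "2 * K \<le> D" "4 * K \<le> ln (D * l / (2 * K))" "4 \<le> ln (D * l / (2 * K))"
  shows "K * 2 ^ n \<le> 4 * D * real (max_code_size n k)"
proof -
  define V where "V = {w\<in>words n. aperiodic (3 * k) h w}"
  \<comment> \<open>Equal lengths make \<open>E\<close> symmetric, since
    \<open>deletion_distance\<close> subtracts from the length of its first argument.\<close>
  define E where "E u v \<longleftrightarrow> u \<noteq> v \<and> length u = length v \<and> deletion_distance u v \<le> k" for u v
  have V: "finite V" using finite_words by (simp add: V_def)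
  obtain I where I: "I \<subseteq> V" "\<forall>x\<in>I. \<forall>y\<in>I. \<not> E x y"
    and card: "K * real (card V) \<le> 2 * D * real (card I)"
  proof (rule independent_set_locally_sparse[OF V _ _ _ _ l K(1) K(2-4)])
    show "E x y \<Longrightarrow> E y x" for x y by (auto simp: E_def deletion_distance_def LCS_commute)
    show "\<not> E x x" for x by (simp add: E_def)
  next
    fix v assume "v \<in> V"
    then have v: "length v = n" by (simp add: V_def words_def)
    have "card {x\<in>V. E v x} \<le> card {x\<in>words n. deletion_distance v x \<le> k}"
      using finite_words by (intro card_mono) (auto simp: V_def E_def)
    also have "\<dots> \<le> 2 ^ k * n ^ (2 * k)" using v k(2) by (rule card_deletion_ball)
    finally have "card {x\<in>V. E v x} \<le> 2 ^ k * n ^ (2 * k)" .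
    then have "real (card {x\<in>V. E v x}) \<le> real (2 ^ k * n ^ (2 * k))" by (simp only: of_nat_le_iff)
    then show "real (card {x\<in>V. E v x}) \<le> D" unfolding D by simp
    let ?T = "{(x, y). x \<in> words n \<and> y \<in> words n \<and> aperiodic (3 * k) h y \<and>
      deletion_distance v x \<le> k \<and> deletion_distance v y \<le> k \<and> deletion_distance x y \<le> k}"
    have "card {(x, y). x \<in> V \<and> y \<in> V \<and> E v x \<and> E v y \<and> E x y} \<le> card ?T"
      by (rule card_mono)
        (auto simp: V_def E_def intro: finite_subset[of _ "words n \<times> words n"] finite_words)
    also have "\<dots> \<le> 4 ^ k * (n ^ (4 * k - 1) *
         (4 * k * (4 * k) * (4 * (h + 4 * k) + 1) + 4 * k * (2 * (h + 4 * k) + 1)))"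
      using v k by (rule card_deletion_triangles) simp
    finally show "real (card {(x, y). x \<in> V \<and> y \<in> V \<and> E v x \<and> E v y \<and> E x y})
      \<le> real (4 ^ k * (n ^ (4 * k - 1) *
         (4 * k * (4 * k) * (4 * (h + 4 * k) + 1) + 4 * k * (2 * (h + 4 * k) + 1))))"
      by (simp only: of_nat_le_iff)
  qed
  \<comment> \<open>The union bound discards at most \<open>3 * k * n * 2 ^ (n - h)\<close> words,
    and \<open>6 * k * n \<le> 2 ^ h\<close> makes this at most half of all.\<close>
  have "2 ^ n \<le> 2 * card V"
  proof -
    have "words n = V \<union> {w\<in>words n. \<not> aperiodic (3 * k) h w}" by (auto simp: V_def)
    then have "2 ^ n \<le> card V + card {w\<in>words n. \<not> aperiodic (3 * k) h w}"
      by (metis card_Un_le card_words)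
    moreover have "card {w\<in>words n. \<not> aperiodic (3 * k) h w} \<le> n * (3 * k) * 2 ^ (n - h)"
      using h(1) by (rule card_not_aperiodic)
    moreover have "2 * (n * (3 * k) * 2 ^ (n - h)) \<le> 2 ^ n"
    proof -
      have "2 * (n * (3 * k) * 2 ^ (n - h)) = 6 * k * n * 2 ^ (n - h)" by simp
      also have "\<dots> \<le> 2 ^ h * 2 ^ (n - h)" using h(2) by (rule mult_right_mono) simp
      also have "\<dots> = 2 ^ n" using h(1) by (metis le_add_diff_inverse power_add)
      finally show ?thesis .
    qed
    ultimately show ?thesis by linarith
  qed
  then have "real (2 ^ n) \<le> real (2 * card V)" by (simp only: of_nat_le_iff)
  then have "(2::real) ^ n \<le> 2 * real (card V)" by simp
  then have "K * 2 ^ n \<le> K * (2 * real (card V))" using K(1) by simp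
  also have "\<dots> \<le> 4 * D * real (card I)" using card by simp
  also have "\<dots> \<le> 4 * D * real (max_code_size n k)"
  proof -
    have "deletion_code n k I"
      unfolding deletion_code_def
    proof (intro conjI ballI impI)
      show "I \<subseteq> words n" using I(1) by (auto simp: V_def)
      then have len: "length u = n" if "u \<in> I" for u using that by (auto simp: words_def)
      fix u v assume "u \<in> I" "v \<in> I" "u \<noteq> v"
      then show "k < deletion_distance u v" using I(2) len[of u] len[of v] by (force simp: E_def)
    qed
    then show ?thesis
      using card_le_max_code_size K(1,2) by (intro mult_left_mono) auto
  qed
  finally show ?thesis .
qed

section \<open>Choice of parameters and asymptotics\<close>

text \<open>The fugacity is \<open>n powr (1/4 - 2 * k)\<close>. Then \<open>D * l\<close> is still
  a power of \<open>n\<close>, so its logarithm has order \<open>ln n\<close>, while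
  \<open>l^2\<close> times the bound on triangles is \<open>O(n powr (-1/2) * ln n)\<close>.\<close>

lemma max_code_size_lower_bound_eventually:
  assumes k: "0 < k"
  shows "\<forall>\<^sub>F n in sequentially.
    2 ^ n * ln (real n) / (256 * 2 ^ k * real n ^ (2 * k)) \<le> real (max_code_size n k)"
proof -
  \<comment> \<open>The constant factor in the bound on triangles is linear in \<open>h\<close>;
    \<alpha> and \<beta> are its coefficients.\<close>
  define \<alpha> where "\<alpha> = 4 ^ k * (64 * real k ^ 2 + 8 * real k)"
  define \<beta> where "\<beta> = 4 ^ k * (16 * real k ^ 2 * (16 * real k + 1) + 4 * real k * (8 * real k + 1))"
  have pos: "real k > 0" "\<alpha> > 0" "\<beta> > 0"
    using k by (auto simp: \<alpha>_def \<beta>_def intro!: add_pos_pos mult_pos_pos)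
  \<comment> \<open>The eventual inequalities supply, in order, \<open>h \<le> n\<close>, the bound
    on \<open>l^2 * M\<close>, \<open>l \<le> 1 / 4\<close>, \<open>2 * K \<le> D\<close>, the two
    conditions on the logarithm, and \<open>max 2 k \<le> n\<close>.\<close>
  have "\<forall>\<^sub>F n in sequentially. log 2 (6 * real k * real n) + 1 \<le> real n"
    using pos by real_asymp
  moreover have "\<forall>\<^sub>F n in sequentially.
      (\<alpha> * (log 2 (6 * real k * real n) + 1) + \<beta>) * real n powr (-1/2) \<le> 1"
    using pos by real_asymp
  moreover have "\<forall>\<^sub>F n in sequentially. real n powr (-1) \<le> 1 / 4" by real_asymp
  moreover have "\<forall>\<^sub>F n in sequentially. ln (real n) / 32 \<le> real n" by real_asymp
  moreover have "\<forall>\<^sub>F n in sequentially.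
      4 * (ln (real n) / 64) \<le> ln (real n powr (1/4) / (ln (real n) / 32))" by real_asymp
  moreover have "\<forall>\<^sub>F n in sequentially.
      4 \<le> ln (real n powr (1/4) / (ln (real n) / 32))" by real_asymp
  moreover have "\<forall>\<^sub>F n in sequentially. max 2 k \<le> n" by (rule eventually_ge_at_top)
  ultimately show ?thesis
  proof eventually_elim
    case (elim n)
    note large = elim
    have n: "2 \<le> n" "k \<le> n" "real n > 1" "real n > 0" using large(7) by auto
    define h where "h = nat \<lceil>log 2 (6 * real k * real n)\<rceil>"
    define l where "l = real n powr (1/4 - 2 * real k)"
    define D where "D = 2 ^ k * real n ^ (2 * k)"
    have k1: "real k \<ge> 1" using k by simp
    have kn: "6 * real k * real n \<ge> 1"
      using mult_mono[of 1 "6 * real k" 1 "real n"] k1 n by simp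
    have "log 2 (6 * real k * real n) \<ge> 0" using kn by (subst zero_le_log_cancel_iff) auto
    then have h: "log 2 (6 * real k * real n) \<le> real h" "real h \<le> log 2 (6 * real k * real n) + 1"
      unfolding h_def by linarith+
    have hn: "h \<le> n" using h(2) large(1) by linarith
    have "6 * real k * real n = 2 powr (log 2 (6 * real k * real n))" using kn by simp
    also have "\<dots> \<le> 2 powr real h" using h(1) by simp
    also have "\<dots> = 2 ^ h" by (simp add: powr_realpow)
    finally have "real (6 * k * n) \<le> real (2 ^ h)" by simp
    then have h6: "6 * k * n \<le> 2 ^ h" by (simp only: of_nat_le_iff)
    have l0: "l > 0" using n by (simp add: l_def)
    have "l \<le> real n powr (-1)"
      unfolding l_def using n k1 by (intro powr_mono) auto
    then have l4: "l \<le> 1 / 4" using large(3) by linarith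
    have Dl: "D * l = 2 ^ k * real n powr (1/4)"
    proof -
      have "real n ^ (2 * k) * l = real n powr (1/4)"
        unfolding l_def using n by (simp add: powr_realpow[symmetric] powr_add[symmetric])
      then show ?thesis by (simp add: D_def)
    qed
    have lM: "l\<^sup>2 * real (4 ^ k * (n ^ (4 * k - 1) *
         (4 * k * (4 * k) * (4 * (h + 4 * k) + 1) + 4 * k * (2 * (h + 4 * k) + 1)))) \<le> 1"
    proof -
      let ?c = "4 * k * (4 * k) * (4 * (h + 4 * k) + 1) + 4 * k * (2 * (h + 4 * k) + 1)"
      have A: "l\<^sup>2 * real n ^ (4 * k - 1) = real n powr (-1/2)"
      proof -
        have "l\<^sup>2 = real n powr (2 * (1/4 - 2 * real k))"
          unfolding l_def power2_eq_square by (simp only: powr_add[symmetric] mult_2)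
        moreover have "real n ^ (4 * k - 1) = real n powr (4 * real k - 1)"
          using n k by (simp add: powr_realpow[symmetric] of_nat_diff)
        ultimately show ?thesis by (simp add: powr_add[symmetric])
      qed
      have B: "real (4 ^ k * ?c) = \<alpha> * real h + \<beta>"
        unfolding \<alpha>_def \<beta>_def by (simp add: algebra_simps power2_eq_square)
      have "l\<^sup>2 * real (4 ^ k * (n ^ (4 * k - 1) * ?c))
          = real (4 ^ k * ?c) * (l\<^sup>2 * real n ^ (4 * k - 1))"
        by (simp only: of_nat_mult of_nat_power mult_ac)
      also have "\<dots> = (\<alpha> * real h + \<beta>) * real n powr (-1/2)" unfolding A B ..
      also have "\<dots> \<le> (\<alpha> * (log 2 (6 * real k * real n) + 1) + \<beta>) * real n powr (-1/2)"
        using h(2) pos by (intro mult_right_mono add_right_mono mult_left_mono) auto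
      finally show ?thesis using large(2) by linarith
    qed
    \<comment> \<open>Here \<open>4 * K\<close> is \<open>ln n / 16\<close>, eventually below
      \<open>ln n / 4\<close> minus a doubly logarithmic term. Dividing by \<open>4 * D\<close>
      produces the constant 256.\<close>
    define K where "K = ln (real n) / 64"
    have K0: "K > 0" using n by (simp add: K_def)
    have "real n \<le> D"
    proof -
      have "1 * real n ^ 1 \<le> 2 ^ k * real n ^ (2 * k)"
        using n k by (intro mult_mono power_increasing) auto
      then show ?thesis by (simp add: D_def)
    qed
    then have KD: "2 * K \<le> D" using large(4) by (simp add: K_def)
    have "ln (real n powr (1/4) / (ln (real n) / 32)) \<le> ln (D * l / (2 * K))"
    proof (rule ln_mono)
      show "real n powr (1/4) / (ln (real n) / 32) > 0" using n by simp
      have "1 * real n powr (1/4) \<le> 2 ^ k * real n powr (1/4)" by (intro mult_right_mono) auto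
      then show "real n powr (1/4) / (ln (real n) / 32) \<le> D * l / (2 * K)"
        unfolding Dl K_def using n by (intro frac_le) auto
    qed
    then have L: "4 * K \<le> ln (D * l / (2 * K))" "4 \<le> ln (D * l / (2 * K))"
      using large(5,6) unfolding K_def by linarith+
    have "K * 2 ^ n \<le> 4 * D * real (max_code_size n k)"
      by (rule max_code_size_ge_hard_core[OF k n(2) hn h6 l0 l4 lM D_def K0 KD L])
    moreover have "D > 0" using n by (simp add: D_def)
    ultimately have "K * 2 ^ n / (4 * D) \<le> real (max_code_size n k)" by (simp add: field_simps)
    then show ?case by (simp add: K_def D_def mult_ac)
  qed
qed

theorem theorem1p1:
  shows "\<forall>k::nat. k \<ge> 2 \<longrightarrow>
    (\<exists>c::real. c > 0 \<and>
      (\<forall>n::nat. n \<ge> k \<longrightarrow>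
        real (max_code_size n k) \<ge> c * (2 ^ n * log 2 (real n) / real n ^ (2 * k))))"
proof (intro allI impI)
  fix k :: nat assume k: "k \<ge> 2"
  define q where "q n = 2 ^ n * log 2 (real n) / real n ^ (2 * k)" for n :: nat
  \<comment> \<open>The factor \<open>ln 2\<close> converts the natural logarithm to base 2.\<close>
  define c1 :: real where "c1 = ln 2 / (256 * 2 ^ k)"
  obtain n0 where n0: "\<And>n. n \<ge> n0 \<Longrightarrow>
      2 ^ n * ln (real n) / (256 * 2 ^ k * real n ^ (2 * k)) \<le> real (max_code_size n k)"
    using max_code_size_lower_bound_eventually[of k] k by (auto simp: eventually_sequentially)
  define Q where "Q = 1 + (\<Sum>n<n0. \<bar>q n\<bar>)"
  have Q: "Q > 0" unfolding Q_def by (intro add_pos_nonneg sum_nonneg) auto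
  \<comment> \<open>Below the threshold \<open>n0\<close>, \<open>Q\<close> dominates
    \<open>q n\<close>, so \<open>c \<le> 1 / Q\<close> reduces the claim to the existence of a code
    with one word.\<close>
  define c where "c = min c1 (1 / Q)"
  have c: "c > 0" using Q by (simp add: c_def c1_def)
  have "c * q n \<le> real (max_code_size n k)" if n: "n \<ge> k" for n
  proof (cases "n \<ge> n0")
    case True
    have "q n \<ge> 0" using n k by (simp add: q_def)
    then have "c * q n \<le> c1 * q n" by (intro mult_right_mono) (auto simp: c_def)
    also have "\<dots> = 2 ^ n * ln (real n) / (256 * 2 ^ k * real n ^ (2 * k))"
      by (simp add: c1_def q_def log_def)
    finally show ?thesis using n0[OF True] by linarith
  next
    case False
    then have "\<bar>q n\<bar> \<le> (\<Sum>n<n0. \<bar>q n\<bar>)" by (intro member_le_sum) auto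
    then have "q n \<le> Q" by (simp add: Q_def)
    then have "c * q n \<le> c * Q" using c by simp
    also have "\<dots> \<le> 1 / Q * Q" using Q by (intro mult_right_mono) (auto simp: c_def)
    also have "\<dots> = 1" using Q by simp
    also have "\<dots> \<le> real (max_code_size n k)" using max_code_size_pos[of n k] by simp
    finally show ?thesis .
  qed
  then show "\<exists>c>0. \<forall>n\<ge>k. real (max_code_size n k) \<ge> c * (2 ^ n * log 2 (real n) / real n ^ (2 * k))"
    using c by (auto simp: q_def)
qed

end
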